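(* Let $(G,w)$ be a road network, $\mathcal{S}$ a scope mapping, and $s\in V(G)$. The $\mathcal{S}$-Dijkstra's algorithm (run with $r\equiv\infty$, i.e. without reach pruning) computes, for every $v\in V(G)$, an optimal $s$-admissible walk from $s$ to $v$ in $G$ (or reports $\infty$ if none exists), in time $\mathcal{O}\big(|E(G)|\cdot|\mathrm{Im}(\mathcal{S})|+|V(G)|\cdot\log|V(G)|\big)$.
   Context: A road network $(G,w)$ is a finite directed multigraph with non-negative edge weights $w$. A scope mapping is $\mathcal{S}:E(G)\to\mathbb{N}_0\cup\{\infty\}$ with $0,\infty\in\mathrm{Im}(\mathcal{S})$, with constants $0=\nu_0<\nu_1<\dots<\nu_\infty=\infty$ for the levels; the turn-scope handicap of $e=(u,v)$ is $h_{\mathcal{S}}(e)=\max(\{\mathcal{S}(e)\}\cup\{\mathcal{S}(f):f=(v,z)\in E(G)\})$, with constants $0<\kappa_0<\dots<\kappa_\infty$ for the levels. An edge $e=(u,v)$ is $x$-admissible in $G$ for $\mathcal{S}$ iff there is a walk $P\subseteq G-e$ from $x$ to $u$ such that (1) every edge of $P$ is $x$-admissible in $G-e$, (2) $P$ has minimum weight subject to (1), and (3) for $\ell=\mathcal{S}(e)$: $\sum_{f\in E(P),\mathcal{S}(f)>\ell}w(f)+\sum_{f\in E(P),h_{\mathcal{S}}(f)>\ell\ge\mathcal{S}(f)}\kappa_\ell\le\nu_\ell$. A walk from $s$ is $s$-admissible if all its edges are $s$-admissible in $G$; an optimal $s$-admissible walk to $v$ is one of minimum weight among $s$-admissible walks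 from $s$ to $v$. The $\mathcal{S}$-Dijkstra's algorithm with input $(G,w,\mathcal{S},s,r)$, $r:V(G)\to\mathbb{R}\cup\{\infty\}$: initialize $d[v]=\infty$, $\pi[v]=\bot$, $\sigma[v]=(\infty,\dots,\infty)$ (a vector indexed by $\mathrm{Im}(\mathcal{S})$) for all $v$; set $d[s]=0$, $\sigma[s]=(0,\dots,0)$, $Q=\{s\}$. While $Q\ne\emptyset$: remove from $Q$ a vertex $u$ with minimum $d[u]$; for each edge $f=(u,v)$: if ($r(v)\ge d[u]+w(f)$ or $\mathcal{S}(f)=\infty$) and $\sigma_{\mathcal{S}(f)}[u]\le\nu_{\mathcal{S}(f)}$, then for each $i\in\mathrm{Im}(\mathcal{S})$ set $\gamma_i=w(f)$ if $\mathcal{S}(f)>i$ and $\gamma_i=0$ otherwise, and add $\kappa_i$ to $\gamma_i$ if $h_{\mathcal{S}}(f)>i\ge\mathcal{S}(f)$; then relax: if $d[u]+w(f)<d[v]$ put $v$ into $Q$ and set $d[v]=d[u]+w(f)$, $\pi[v]=u$; and if $d[u]+w(f)\le d[v]$ set $\sigma_i[v]=\min(\sigma_i[v],\sigma_i[u]+\gamma_i)$ for all $i$. Finally the walks are read off from the predecessors $\pi$.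
   Formalization: Two corrections: when d[v] strictly decreases, the vector σ[v] is first reset to ∞; and correctness is claimed only for positive edge weights (termination and running time for all non-negative ones). Queue operations are charged at Fibonacci-heap amortised costs. *)

theory Defs
  imports
    "Graph_Theory.Graph_Theory"
    "Graph_Theory.Weighted_Graph"
    "HOL-Library.Extended_Nat"
    "HOL-Library.Extended_Real"
begin

locale road_network = fin_digraph G for G :: "('v, 'e) pre_digraph" +
  fixes w :: "'e \<Rightarrow> real"
  assumes weight_nonneg: "e \<in> arcs G \<Longrightarrow> 0 \<le> w e"

definition levels :: "('v, 'e) pre_digraph \<Rightarrow> ('e \<Rightarrow> enat) \<Rightarrow> enat set" where
  "levels G S = S ` arcs G"

text \<open>
  The constants \<open>\<nu>\<close> and \<open>\<kappa>\<close> are indexed by the scope levels themselves, so that strict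
  monotonicity on the levels is the chain of inequalities between consecutive constants. In
  particular both are finite at every level other than \<open>\<infinity>\<close>.
\<close>

locale scope_mapping =
  fixes G :: "('v, 'e) pre_digraph" and S :: "'e \<Rightarrow> enat" and \<nu> \<kappa> :: "enat \<Rightarrow> ereal"
  assumes zero_level: "0 \<in> levels G S"
    and infinite_level: "\<infinity> \<in> levels G S"
    and nu_zero: "\<nu> 0 = 0"
    and nu_infinity: "\<nu> \<infinity> = \<infinity>"
    and nu_strict_mono: "strict_mono_on (levels G S) \<nu>"
    and kappa_zero: "0 < \<kappa> 0"
    and kappa_strict_mono: "strict_mono_on (levels G S) \<kappa>"

definition handicap :: "('v, 'e) pre_digraph \<Rightarrow> ('e \<Rightarrow> enat) \<Rightarrow> 'e \<Rightarrow> enat" where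
  "handicap G S e = Max ({S e} \<union> S ` out_arcs G (head G e))"

text \<open>
  The amount to be compared with \<open>\<nu> l\<close> when a walk \<open>p\<close> is continued by an arc of scope \<open>l\<close>; \<open>h\<close> is
  the turn-scope handicap. Arcs are counted with multiplicity; this does not affect which arcs are
  admissible, because a closed detour on a walk of minimum weight can be removed.
\<close>

definition scope_usage ::
  "('e \<Rightarrow> real) \<Rightarrow> ('e \<Rightarrow> enat) \<Rightarrow> ('e \<Rightarrow> enat) \<Rightarrow> (enat \<Rightarrow> ereal) \<Rightarrow> enat \<Rightarrow> 'e list \<Rightarrow> ereal"
  where
  "scope_usage w S h \<kappa> l p =
     (\<Sum>f\<leftarrow>filter (\<lambda>f. S f > l) p. ereal (w f)) +
     (\<Sum>f\<leftarrow>filter (\<lambda>f. h f > l \<and> l \<ge> S f) p. \<kappa> l)"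

text \<open>
  Admissibility, by recursion on the number of arcs. Deleting an arc changes neither the scope
  mapping nor the handicap function \<open>h\<close> attached to it.
\<close>

context
  fixes w :: "'e \<Rightarrow> real" and S h :: "'e \<Rightarrow> enat" and \<nu> \<kappa> :: "enat \<Rightarrow> ereal" and x :: 'v
begin

declare conj_cong [fundef_cong]

function admissible_arc :: "('v, 'e) pre_digraph \<Rightarrow> 'e \<Rightarrow> bool" where
  "admissible_arc G e \<longleftrightarrow>
     finite (arcs G) \<and> e \<in> arcs G \<and>
     (\<exists>p. pre_digraph.awalk (pre_digraph.del_arc G e) x p (tail G e) \<and>
        (\<forall>f\<in>set p. admissible_arc (pre_digraph.del_arc G e) f) \<and>
        (\<forall>q. pre_digraph.awalk (pre_digraph.del_arc G e) x q (tail G e) \<and>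
             (\<forall>f\<in>set q. admissible_arc (pre_digraph.del_arc G e) f) \<longrightarrow>
             wf_digraph.awalk_cost w p \<le> wf_digraph.awalk_cost w q) \<and>
        scope_usage w S h \<kappa> (S e) p \<le> \<nu> (S e))"
  by pat_completeness auto
termination
  by (relation "measure (\<lambda>(G, e). card (arcs G))")
    (auto simp: pre_digraph.del_arc_simps card_gt_0_iff intro!: diff_less)

declare conj_cong [fundef_cong del]
declare admissible_arc.simps [simp del]

definition admissible_walk :: "('v, 'e) pre_digraph \<Rightarrow> 'e list \<Rightarrow> 'v \<Rightarrow> bool" where
  "admissible_walk G p v \<longleftrightarrow>
     pre_digraph.awalk G x p v \<and> (\<forall>f\<in>set p. admissible_arc G f)"

definition optimal_admissible_walk :: "('v, 'e) pre_digraph \<Rightarrow> 'e list \<Rightarrow> 'v \<Rightarrow> bool" where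
  "optimal_admissible_walk G p v \<longleftrightarrow>
     admissible_walk G p v \<and>
     (\<forall>q. admissible_walk G q v \<longrightarrow> wf_digraph.awalk_cost w p \<le> wf_digraph.awalk_cost w q)"

end

text \<open>
  States of the algorithm. As the graph may have parallel arcs, \<open>parc\<close> stores the arc through
  which a vertex was last improved instead of only the tail of that arc (the predecessor \<open>\<pi>\<close>).

  The component \<open>time\<close> counts unit-cost operations on weights, levels and pointers. The priority
  queue is charged the amortised costs of a Fibonacci heap (Fredman and Tarjan): constant for
  insertion and key decrease, logarithmic in the size of the queue for extracting a minimum.
\<close>

record ('v, 'e) sd_state =
  dval :: "'v \<Rightarrow> ereal"
  parc :: "'v \<Rightarrow> 'e option"
  sig :: "'v \<Rightarrow> enat \<Rightarrow> ereal"
  queue :: "'v set"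
  time :: real

text \<open>
  The initial cost covers filling \<open>dval\<close>, \<open>parc\<close> and an array of pointers \<open>sig\<close>, where all
  vertices other than the source share one constant vector, inserting the source into the queue,
  and tabulating the set of levels, the level index of every arc (found by scanning the list of
  levels) and the handicaps. A proper vector for a vertex is allocated, and paid for, in
  \<open>sd_relax\<close>, when the vertex is first reached.
\<close>

definition sd_init :: "('v, 'e) pre_digraph \<Rightarrow> ('e \<Rightarrow> enat) \<Rightarrow> 'v \<Rightarrow> ('v, 'e) sd_state" where
  "sd_init G S s =
    \<lparr>dval = (\<lambda>_. \<infinity>)(s := 0),
     parc = (\<lambda>_. None),
     sig = (\<lambda>_ _. \<infinity>)(s := (\<lambda>_. 0)),
     queue = {s},
     time = 3 * real (card (verts G)) + 2 * real (card (levels G S)) + 1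
            + real (card (arcs G)) * (2 + real (card (levels G S)))\<rparr>"

text \<open>
  Relaxation of the arc \<open>f\<close> with scope increments \<open>\<gamma>\<close>. A strict improvement of \<open>dval\<close> discards
  the scope vector of the head, which refers to walks that have just turned out not to be optimal.
\<close>

definition sd_relax ::
  "('v, 'e) pre_digraph \<Rightarrow> ('e \<Rightarrow> real) \<Rightarrow> ('e \<Rightarrow> enat) \<Rightarrow> 'e \<Rightarrow> (enat \<Rightarrow> ereal) \<Rightarrow>
   ('v, 'e) sd_state \<Rightarrow> ('v, 'e) sd_state"
  where
  "sd_relax G w S f \<gamma> st =
    (let u = tail G f; v = head G f; k = real (card (levels G S));
         d = dval st u + ereal (w f);
         st = (if d < dval st v
               then st\<lparr>queue := insert v (queue st),
                       dval := (dval st)(v := d),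
                       parc := (parc st)(v := Some f),
                       sig := (sig st)(v := (\<lambda>_. \<infinity>)),
                       time := time st + 3 + k\<rparr>
               else st)
     in if d \<le> dval st v
        then st\<lparr>sig := (sig st)(v := (\<lambda>i. min (sig st v i) (sig st u i + \<gamma> i))),
                time := time st + k\<rparr>
        else st)"

definition sd_scan_arc ::
  "('v, 'e) pre_digraph \<Rightarrow> ('e \<Rightarrow> real) \<Rightarrow> ('e \<Rightarrow> enat) \<Rightarrow> (enat \<Rightarrow> ereal) \<Rightarrow> (enat \<Rightarrow> ereal) \<Rightarrow>
   ('v \<Rightarrow> ereal) \<Rightarrow> 'e \<Rightarrow> ('v, 'e) sd_state \<Rightarrow> ('v, 'e) sd_state"
  where
  "sd_scan_arc G w S \<nu> \<kappa> r f st =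
    (let u = tail G f; v = head G f; k = real (card (levels G S)) in
     if (r v \<ge> dval st u + ereal (w f) \<or> S f = \<infinity>) \<and> sig st u (S f) \<le> \<nu> (S f)
     then sd_relax G w S f
            (\<lambda>i. (if S f > i then ereal (w f) else 0) +
                 (if handicap G S f > i \<and> i \<ge> S f then \<kappa> i else 0))
            (st\<lparr>time := time st + 4 + k\<rparr>)
     else st\<lparr>time := time st + 2\<rparr>)"

text \<open>
  One iteration of the main loop. Both the choice among the vertices of minimum key and the order
  in which the outgoing arcs are scanned are left open.
\<close>

definition sd_step ::
  "('v, 'e) pre_digraph \<Rightarrow> ('e \<Rightarrow> real) \<Rightarrow> ('e \<Rightarrow> enat) \<Rightarrow> (enat \<Rightarrow> ereal) \<Rightarrow> (enat \<Rightarrow> ereal) \<Rightarrow>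
   ('v \<Rightarrow> ereal) \<Rightarrow> ('v, 'e) sd_state \<Rightarrow> ('v, 'e) sd_state \<Rightarrow> bool"
  where
  "sd_step G w S \<nu> \<kappa> r st st' \<longleftrightarrow>
    (\<exists>u fs. u \<in> queue st \<and> (\<forall>x\<in>queue st. dval st u \<le> dval st x) \<and>
       distinct fs \<and> set fs = out_arcs G u \<and>
       st' = fold (sd_scan_arc G w S \<nu> \<kappa> r) fs
         (st\<lparr>queue := queue st - {u},
             time := time st + 1 + log 2 (real (card (queue st)))\<rparr>))"

abbreviation sd_reachable ::
  "('v, 'e) pre_digraph \<Rightarrow> ('e \<Rightarrow> real) \<Rightarrow> ('e \<Rightarrow> enat) \<Rightarrow> (enat \<Rightarrow> ereal) \<Rightarrow> (enat \<Rightarrow> ereal) \<Rightarrow>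
   ('v \<Rightarrow> ereal) \<Rightarrow> 'v \<Rightarrow> ('v, 'e) sd_state \<Rightarrow> bool"
  where
  "sd_reachable G w S \<nu> \<kappa> r s st \<equiv> (sd_step G w S \<nu> \<kappa> r)\<^sup>*\<^sup>* (sd_init G S s) st"

text \<open>
  Every execution from the initial state is finite and can only end with an empty queue.
\<close>

definition sd_terminates ::
  "('v, 'e) pre_digraph \<Rightarrow> ('e \<Rightarrow> real) \<Rightarrow> ('e \<Rightarrow> enat) \<Rightarrow> (enat \<Rightarrow> ereal) \<Rightarrow> (enat \<Rightarrow> ereal) \<Rightarrow>
   ('v \<Rightarrow> ereal) \<Rightarrow> 'v \<Rightarrow> bool"
  where
  "sd_terminates G w S \<nu> \<kappa> r s \<longleftrightarrow>
     (\<nexists>run. run 0 = sd_init G S s \<and> (\<forall>i::nat. sd_step G w S \<nu> \<kappa> r (run i) (run (Suc i)))) \<and>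
     (\<forall>st. sd_reachable G w S \<nu> \<kappa> r s st \<and> queue st \<noteq> {} \<longrightarrow> (\<exists>st'. sd_step G w S \<nu> \<kappa> r st st'))"

text \<open>The walk to \<open>v\<close> that is read off by following predecessor arcs backwards.\<close>

inductive read_off :: "('v, 'e) pre_digraph \<Rightarrow> ('v \<Rightarrow> 'e option) \<Rightarrow> 'v \<Rightarrow> 'e list \<Rightarrow> bool"
  for G \<pi> where
  "\<pi> v = None \<Longrightarrow> read_off G \<pi> v []"
| "\<pi> v = Some f \<Longrightarrow> read_off G \<pi> (tail G f) p \<Longrightarrow> read_off G \<pi> v (p @ [f])"

end

theory Submission
  imports Defs
begin

text \<open>
  Let the weights be positive. Call a set \<open>A\<close> of arcs a solution for a set \<open>E\<close> if it consists of those
  \<open>e\<close> in \<open>E\<close> whose tail is reached by an optimal walk within \<open>A\<close> that satisfies the scope condition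
  of \<open>e\<close>. No arc deletions occur in this fixpoint condition, and it is local: membership of \<open>e\<close> depends
  only on walks that are cheaper than any walk through \<open>e\<close>. Hence solutions for \<open>E\<close> and \<open>E - {e}\<close> have
  the same walks up to the distance of the tail of \<open>e\<close>, and induction on the number of arcs identifies
  every solution with the set of admissible arcs. The arcs that pass the test of the algorithm form
  a solution, because the final labels are the distances, and the minimal scope usages of optimal
  walks, with respect to these arcs.
\<close>

section \<open>The fixpoint characterisation of admissibility\<close>

locale positive_network = road_network G w
  for G :: "('v, 'e) pre_digraph" and w :: "'e \<Rightarrow> real" +
  fixes S h :: "'e \<Rightarrow> enat" and \<nu> \<kappa> :: "enat \<Rightarrow> ereal" and s :: 'v
  assumes weight_pos: "e \<in> arcs G \<Longrightarrow> 0 < w e"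
begin

section \<open>Walks within an arc set, and their costs measured in multiples of the least
  weight\<close>

definition optimal_within :: "'e set \<Rightarrow> 'e list \<Rightarrow> 'v \<Rightarrow> bool" where
  "optimal_within A p v \<longleftrightarrow> awalk s p v \<and> set p \<subseteq> A \<and>
     (\<forall>q. awalk s q v \<and> set q \<subseteq> A \<longrightarrow> awalk_cost w p \<le> awalk_cost w q)"

definition usable :: "'e \<Rightarrow> 'e list \<Rightarrow> bool" where
  "usable e p \<longleftrightarrow> scope_usage w S h \<kappa> (S e) p \<le> \<nu> (S e)"

definition solution :: "'e set \<Rightarrow> 'e set \<Rightarrow> bool" where
  "solution E A \<longleftrightarrow> A \<subseteq> E \<and>
     (\<forall>e\<in>E. e \<in> A \<longleftrightarrow> (\<exists>p. optimal_within A p (tail G e) \<and> usable e p))"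

text \<open>Costs are real numbers, so inductions on cost run over multiples of this positive bound
  instead. The element \<open>1\<close> keeps the set nonempty when there are no arcs.\<close>

definition min_weight :: real where
  "min_weight = Min (insert 1 (w ` arcs G))"

lemma min_weight_pos: "0 < min_weight"
  unfolding min_weight_def using weight_pos by (subst Min_gr_iff) auto

lemma min_weight_le: "e \<in> arcs G \<Longrightarrow> min_weight \<le> w e"
  unfolding min_weight_def by (intro Min_le) auto

lemma awalk_cost_nonneg: "set p \<subseteq> arcs G \<Longrightarrow> 0 \<le> awalk_cost w p"
  by (induction p) (auto simp: weight_nonneg)

text \<open>The part of the walk before \<open>f\<close> omits \<open>f\<close>, whose weight alone
  is at least \<open>min_weight\<close>.\<close>

lemma walk_prefix:
  assumes "awalk s p v" "f \<in> set p"
  obtains p' where "awalk s p' (tail G f)" "set p' \<subseteq> set p"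
    "awalk_cost w p' + min_weight \<le> awalk_cost w p"
proof -
  obtain a b where p: "p = a @ f # b" using assms(2) split_list by fastforce
  have "awalk s a (tail G f)"
    using assms(1) unfolding p awalk_append_iff awalk_Cons_iff by auto
  moreover have "set p \<subseteq> arcs G" using assms(1) by auto
  then have "awalk_cost w a + min_weight \<le> awalk_cost w p"
    using min_weight_le[of f] awalk_cost_nonneg[of b] by (auto simp: p)
  ultimately show thesis using that[of a] by (auto simp: p)
qed

lemma cost_below_multiple:
  obtains n where "awalk_cost w p < real n * min_weight"
  using reals_Archimedean3[OF min_weight_pos] by blast

lemma walk_below_Suc:
  assumes "awalk s p v" "f \<in> set p" "awalk_cost w p < real (Suc n) * min_weight"
  obtains p' where "awalk s p' (tail G f)" "set p' \<subseteq> set p"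
    "awalk_cost w p' < real n * min_weight" "awalk_cost w p' < awalk_cost w p"
proof -
  obtain p' where "awalk s p' (tail G f)" "set p' \<subseteq> set p"
    "awalk_cost w p' + min_weight \<le> awalk_cost w p" using walk_prefix[OF assms(1,2)] .
  then show thesis using that assms(3) min_weight_pos by (auto simp: algebra_simps)
qed

text \<open>Optimality is local in cost: a competitor costing more than \<open>c\<close> cannot beat
  \<open>p\<close>, and on walks of cost at most \<open>c\<close>, including \<open>p\<close>
  itself, \<open>A\<close> and \<open>B\<close> agree.\<close>

lemma optimal_within_transfer:
  assumes "optimal_within A p v" "awalk_cost w p \<le> c"
    and "\<And>q. awalk s q v \<Longrightarrow> awalk_cost w q \<le> c \<Longrightarrow> set q \<subseteq> A \<longleftrightarrow> set q \<subseteq> B"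
  shows "optimal_within B p v"
  using assms unfolding optimal_within_def by (meson dual_order.trans nle_le)

text \<open>Positive weights bound the length of every walk that is no costlier than
  \<open>r\<close>, so the minimum is taken over finitely many walks.\<close>

lemma optimal_within_exists:
  assumes r: "awalk s r v" "set r \<subseteq> A"
  obtains p where "optimal_within A p v"
proof -
  let ?Q = "{q. awalk s q v \<and> set q \<subseteq> A \<and> awalk_cost w q \<le> awalk_cost w r}"
  have len: "real (length q) * min_weight \<le> awalk_cost w q" if "set q \<subseteq> arcs G" for q
    using that by (induction q) (auto simp: algebra_simps dest!: min_weight_le)
  obtain n where n: "awalk_cost w r < real n * min_weight" using cost_below_multiple .
  have "?Q \<subseteq> {q. set q \<subseteq> arcs G \<and> length q \<le> n}"
  proof safe
    fix q assume q: "awalk s q v" "awalk_cost w q \<le> awalk_cost w r"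
    show "f \<in> arcs G" if "f \<in> set q" for f using q that by auto
    have "real (length q) * min_weight < real n * min_weight" using len[of q] q n by auto
    then show "length q \<le> n" using min_weight_pos by simp
  qed
  then have "finite ?Q" using finite_lists_length_le finite_subset finite_arcs by blast
  then obtain p where "is_arg_min (awalk_cost w) (\<lambda>q. q \<in> ?Q) p"
    using ex_is_arg_min_if_finite[of ?Q] r by blast
  then have p: "awalk s p v" "set p \<subseteq> A" "awalk_cost w p \<le> awalk_cost w r"
    and min: "\<And>q. q \<in> ?Q \<Longrightarrow> awalk_cost w p \<le> awalk_cost w q"
    by (auto simp: is_arg_min_linorder)
  have "awalk_cost w p \<le> awalk_cost w q" if "awalk s q v" "set q \<subseteq> A" for q
    using min[of q] p(3) that by (cases "awalk_cost w q \<le> awalk_cost w r") auto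
  with p have "optimal_within A p v" by (simp add: optimal_within_def)
  then show thesis using that by blast
qed

section \<open>Deleting an arc from the ground set of a solution\<close>

text \<open>Here \<open>T\<close> bounds from below the distance of the tail of \<open>e\<close>
  within \<open>A\<close>. Whether an arc of \<open>p\<close> belongs to a solution is decided by
  optimal walks to its tail, which are strictly cheaper than \<open>p\<close>. Below
  \<open>T\<close> these walks never see \<open>e\<close>.\<close>

lemma solution_delete_arc:
  assumes sol: "solution E A" "solution (E - {e}) A'"
    and T: "\<And>q. awalk s q (tail G e) \<Longrightarrow> set q \<subseteq> A \<Longrightarrow> T \<le> awalk_cost w q"
    and p: "awalk s p v" "awalk_cost w p \<le> T"
  shows "set p \<subseteq> A \<longleftrightarrow> set p \<subseteq> A'"
proof -
  have "awalk_cost w p < real n * min_weight \<Longrightarrow> ?thesis" for n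
    using p
  proof (induction n arbitrary: p v)
    case 0
    then show ?case using awalk_cost_nonneg[of p] by auto
  next
    case (Suc n)
    \<comment> \<open>The induction hypothesis, in the form needed by
      \<open>optimal_within_transfer\<close> with the cost of a proper prefix as threshold.\<close>
    have agree: "set q \<subseteq> A \<longleftrightarrow> set q \<subseteq> A'"
      if "awalk_cost w p' < real n * min_weight" "awalk_cost w p' < awalk_cost w p"
        "awalk s q u" "awalk_cost w q \<le> awalk_cost w p'" for p' q u
      by (rule Suc.IH[OF that(1)[THEN le_less_trans[OF that(4)]] that(3)])
        (use that Suc.prems(3) in linarith)
    show ?case
    proof (intro iffI subsetI)
      fix f assume pA: "set p \<subseteq> A" and f: "f \<in> set p"
      obtain p' where p': "awalk s p' (tail G f)" "set p' \<subseteq> set p"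
        "awalk_cost w p' < real n * min_weight" "awalk_cost w p' < awalk_cost w p"
        using walk_below_Suc[OF Suc.prems(2) f Suc.prems(1)] .
      \<comment> \<open>Otherwise \<open>p'\<close> would reach the tail of \<open>e\<close> within
        \<open>A\<close> at a cost below \<open>T\<close>.\<close>
      have "f \<noteq> e" using T[of p'] p' pA Suc.prems(3) by auto
      have "f \<in> A" using pA f by auto
      then have fE: "f \<in> E - {e}" using sol \<open>f \<noteq> e\<close> by (auto simp: solution_def)
      obtain q where q: "optimal_within A q (tail G f)" "usable f q"
        using sol(1) \<open>f \<in> A\<close> by (auto simp: solution_def)
      then have "awalk_cost w q \<le> awalk_cost w p'"
        using p' pA by (auto simp: optimal_within_def)
      then have "optimal_within A' q (tail G f)"
        by (rule optimal_within_transfer[OF q(1)]) (simp add: agree[OF p'(3,4)])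
      then show "f \<in> A'" using sol(2) fE q(2) by (auto simp: solution_def)
    next
      fix f assume pA: "set p \<subseteq> A'" and f: "f \<in> set p"
      obtain p' where p': "awalk s p' (tail G f)" "set p' \<subseteq> set p"
        "awalk_cost w p' < real n * min_weight" "awalk_cost w p' < awalk_cost w p"
        using walk_below_Suc[OF Suc.prems(2) f Suc.prems(1)] .
      have "f \<in> A'" using pA f by auto
      then have fE: "f \<in> E" "f \<in> E - {e}" using sol by (auto simp: solution_def)
      then obtain q where q: "optimal_within A' q (tail G f)" "usable f q"
        using sol(2) \<open>f \<in> A'\<close> by (auto simp: solution_def)
      then have "awalk_cost w q \<le> awalk_cost w p'"
        using p' pA by (auto simp: optimal_within_def)
      then have "optimal_within A q (tail G f)"
        by (rule optimal_within_transfer[OF q(1)]) (simp add: agree[OF p'(3,4)])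
      then show "f \<in> A" using sol(1) fE q(2) by (auto simp: solution_def)
    qed
  qed
  then show ?thesis using cost_below_multiple by blast
qed

text \<open>Applies \<open>solution_delete_arc\<close> with the distance of the tail of
  \<open>e\<close> as threshold. This lets the recursion in \<open>admissible_arc\<close>, which
  deletes \<open>e\<close>, be replaced by a condition on one fixed set.\<close>

lemma optimal_within_delete_arc:
  assumes sol: "solution E A" "solution (E - {e}) A'"
  shows "optimal_within A p (tail G e) \<longleftrightarrow> optimal_within A' p (tail G e)"
proof
  assume p: "optimal_within A p (tail G e)"
  then show "optimal_within A' p (tail G e)"
    using optimal_within_transfer[OF p order_refl]
      solution_delete_arc[OF sol, of "awalk_cost w p"]
    by (auto simp: optimal_within_def)
next
  assume p: "optimal_within A' p (tail G e)"
  show "optimal_within A p (tail G e)"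
  proof (cases "\<exists>r. optimal_within A r (tail G e)")
    case True
    then obtain r where r: "optimal_within A r (tail G e)" ..
    then have agree: "set q \<subseteq> A \<longleftrightarrow> set q \<subseteq> A'"
      if "awalk s q (tail G e)" "awalk_cost w q \<le> awalk_cost w r" for q
      using solution_delete_arc[OF sol _ that] by (auto simp: optimal_within_def)
    \<comment> \<open>The walk \<open>r\<close> also lies in \<open>A'\<close>, so the optimal
      \<open>p\<close> is no costlier and falls below the threshold.\<close>
    have "awalk_cost w p \<le> awalk_cost w r"
      using p r agree[of r] by (auto simp: optimal_within_def)
    then show ?thesis by (rule optimal_within_transfer[OF p]) (use agree in auto)
  next
    case False
    \<comment> \<open>With no walk to the tail of \<open>e\<close> within \<open>A\<close>, every
      threshold qualifies vacuously; the cost of \<open>p\<close> is taken.\<close>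
    then have "awalk_cost w p \<le> awalk_cost w q" if "awalk s q (tail G e)" "set q \<subseteq> A" for q
      using optimal_within_exists that by metis
    then show ?thesis
      using optimal_within_transfer[OF p order_refl]
        solution_delete_arc[OF sol, of "awalk_cost w p"]
      by (simp add: optimal_within_def)
  qed
qed

text \<open>
  Existence of solutions: \<open>layer E n\<close> is correct for arcs whose tail is at distance less than
  \<open>n * min_weight\<close>, because every arc of a walk is preceded by a walk that is cheaper by at least
  \<open>min_weight\<close>.
\<close>

primrec layer :: "'e set \<Rightarrow> nat \<Rightarrow> 'e set" where
  "layer E 0 = {}"
| "layer E (Suc n) = {e \<in> E. \<exists>p. optimal_within (layer E n) p (tail G e) \<and>
     awalk_cost w p < real (Suc n) * min_weight \<and> usable e p}"

text \<open>The shift by one: on a walk cheaper than \<open>Suc n\<close> multiples, every arc has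
  its tail reached below \<open>n\<close> multiples, where membership is already settled in layer
  \<open>n\<close>. For \<open>n = 0\<close> the walk is empty.\<close>

lemma layer_agree:
  assumes "awalk s p v" "awalk_cost w p < real (Suc n) * min_weight" "n \<le> m"
  shows "set p \<subseteq> layer E n \<longleftrightarrow> set p \<subseteq> layer E m"
  using assms
proof (induction n arbitrary: m p v)
  case 0
  have "p = []"
  proof (rule ccontr)
    assume "p \<noteq> []"
    then have "hd p \<in> set p" by simp
    from walk_below_Suc[OF 0(1) this 0(2)] obtain p' where "awalk s p' (tail G (hd p))"
      "awalk_cost w p' < real 0 * min_weight" by metis
    then show False using awalk_cost_nonneg[of p'] by auto
  qed
  then show ?case by simp
next
  case (Suc n)
  obtain m' where m: "m = Suc m'" "n \<le> m'" using Suc.prems(3) by (cases m) auto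
  have agree: "set q \<subseteq> layer E n \<longleftrightarrow> set q \<subseteq> layer E k"
    if "awalk s q u" "awalk_cost w q < real (Suc n) * min_weight" "n \<le> k" for q u k
    using Suc.IH that .
  have mult_le: "real (Suc n) * min_weight \<le> real (Suc m') * min_weight"
    using min_weight_pos m(2) by (intro mult_right_mono) auto
  show ?case
  proof (intro iffI subsetI)
    fix f assume pA: "set p \<subseteq> layer E (Suc n)" and "f \<in> set p"
    then have "f \<in> layer E (Suc n)" by auto
    then obtain q where fE: "f \<in> E" and q: "optimal_within (layer E n) q (tail G f)"
      "awalk_cost w q < real (Suc n) * min_weight" "usable f q" by auto
    have "optimal_within (layer E m') q (tail G f)"
      by (rule optimal_within_transfer[OF q(1) order_refl])
        (use agree m(2) q(2) in auto)
    then show "f \<in> layer E m" using fE q m mult_le by auto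
  next
    fix f assume pA: "set p \<subseteq> layer E m" and f: "f \<in> set p"
    then have "f \<in> layer E (Suc m')" using m by auto
    then obtain q where fE: "f \<in> E" and q: "optimal_within (layer E m') q (tail G f)"
      "usable f q" by auto
    obtain p' where p': "awalk s p' (tail G f)" "set p' \<subseteq> set p"
      "awalk_cost w p' < real (Suc n) * min_weight"
      using walk_below_Suc[OF Suc.prems(1) f Suc.prems(2)] .
    \<comment> \<open>The prefix is known to lie in layer \<open>m\<close> only. It is moved down to
      \<open>n\<close> and up to \<open>m'\<close>, where \<open>q\<close> is optimal and hence no
      costlier.\<close>
    have "set p' \<subseteq> layer E n"
      using agree[OF p'(1,3), of m] pA p'(2) Suc.prems(3) by auto
    then have "set p' \<subseteq> layer E m'" using agree[OF p'(1,3) m(2)] by auto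
    then have le: "awalk_cost w q \<le> awalk_cost w p'"
      using q(1) p'(1) by (auto simp: optimal_within_def)
    have "optimal_within (layer E n) q (tail G f)"
      by (rule optimal_within_transfer[OF q(1) order_refl]) (use agree m(2) le p'(3) in auto)
    then show "f \<in> layer E (Suc n)" using fE q(2) le p'(3) by auto
  qed
qed

text \<open>The cost bound in \<open>layer\<close> restricts the witnesses to the range of
  \<open>layer_agree\<close>, so they stay optimal in later layers.\<close>

lemma layer_mono: "n \<le> m \<Longrightarrow> layer E n \<subseteq> layer E m"
proof (cases n)
  case (Suc k)
  assume "n \<le> m"
  then obtain l where m: "m = Suc l" "k \<le> l" using Suc by (cases m) auto
  have mult_le: "real (Suc k) * min_weight \<le> real (Suc l) * min_weight"
    using min_weight_pos m(2) by (intro mult_right_mono) auto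
  have "optimal_within (layer E l) p v"
    if "optimal_within (layer E k) p v" "awalk_cost w p < real (Suc k) * min_weight" for p v
    by (rule optimal_within_transfer[OF that(1) order_refl])
      (use layer_agree[OF _ _ m(2)] that(2) in auto)
  then show ?thesis using Suc m mult_le by fastforce
qed simp

lemma layer_Union_agree:
  assumes "awalk s p v" "awalk_cost w p < real (Suc n) * min_weight"
  shows "set p \<subseteq> layer E n \<longleftrightarrow> set p \<subseteq> (\<Union>k. layer E k)"
proof
  assume "set p \<subseteq> (\<Union>k. layer E k)"
  \<comment> \<open>A walk has finitely many arcs, so by monotonicity a single layer contains them
    all.\<close>
  then have "\<exists>m\<ge>n. set p \<subseteq> layer E m"
  proof (induction p)
    case (Cons f p)
    then obtain m k where "m \<ge> n" "set p \<subseteq> layer E m" "f \<in> layer E k" by auto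
    then show ?case
      using layer_mono[of m "max m k" E] layer_mono[of k "max m k" E]
      by (intro exI[of _ "max m k"]) auto
  qed auto
  then show "set p \<subseteq> layer E n" using layer_agree[OF assms] by blast
qed auto

lemma solution_layers: "solution E (\<Union>n. layer E n)"
  unfolding solution_def
proof (intro conjI ballI iffI)
  show "(\<Union>n. layer E n) \<subseteq> E"
  proof safe
    fix e n assume "e \<in> layer E n"
    then show "e \<in> E" by (cases n) auto
  qed
next
  fix e assume "e \<in> (\<Union>n. layer E n)"
  then obtain m where m: "e \<in> layer E m" by auto
  then obtain n where "m = Suc n" by (cases m) auto
  then obtain p where p: "optimal_within (layer E n) p (tail G e)"
      "awalk_cost w p < real (Suc n) * min_weight" "usable e p"
    using m by auto
  have "optimal_within (\<Union>n. layer E n) p (tail G e)"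
    by (rule optimal_within_transfer[OF p(1) order_refl])
      (use layer_Union_agree p(2) in auto)
  then show "\<exists>p. optimal_within (\<Union>n. layer E n) p (tail G e) \<and> usable e p" using p(3) by blast
next
  fix e assume e: "e \<in> E"
    and "\<exists>p. optimal_within (\<Union>n. layer E n) p (tail G e) \<and> usable e p"
  then obtain p where p: "optimal_within (\<Union>n. layer E n) p (tail G e)" "usable e p" by blast
  obtain n where "awalk_cost w p < real n * min_weight" using cost_below_multiple .
  then have n: "awalk_cost w p < real (Suc n) * min_weight"
    using min_weight_pos by (simp add: algebra_simps)
  have "optimal_within (layer E n) p (tail G e)"
    by (rule optimal_within_transfer[OF p(1) order_refl])
      (use layer_Union_agree n in \<open>metis dual_order.strict_trans2\<close>)
  then have "e \<in> layer E (Suc n)" using e p(2) n by auto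
  then show "e \<in> (\<Union>n. layer E n)" by blast
qed

section \<open>Solutions are the sets of admissible arcs\<close>

text \<open>Allows the smaller graphs arising from deletions to be treated as arc sets of the one
  graph \<open>G\<close>.\<close>

lemma awalk_restrict_arcs:
  "E \<subseteq> arcs G \<Longrightarrow>
    pre_digraph.awalk (G\<lparr>arcs := E\<rparr>) x p v \<longleftrightarrow> awalk x p v \<and> set p \<subseteq> E"
proof -
  have "pre_digraph.cas (G\<lparr>arcs := E\<rparr>) x p v \<longleftrightarrow> cas x p v"
    by (induction p arbitrary: x) (auto simp: pre_digraph.cas.simps)
  then show "E \<subseteq> arcs G \<Longrightarrow> ?thesis" by (auto simp: pre_digraph.awalk_def)
qed

text \<open>For \<open>e\<close> in \<open>E\<close>, some solution \<open>B\<close> for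
  \<open>E - {e}\<close> exists by \<open>solution_layers\<close> and is the set of admissible arcs
  there by induction. One unfolding of \<open>admissible_arc\<close> then tests \<open>e\<close>
  against \<open>B\<close>, and \<open>optimal_within_delete_arc\<close> replaces \<open>B\<close>
  by \<open>A\<close>. In particular solutions are unique.\<close>

lemma solution_eq_admissible:
  assumes "E \<subseteq> arcs G" "solution E A"
  shows "A = {e. admissible_arc w S h \<nu> \<kappa> s (G\<lparr>arcs := E\<rparr>) e}"
  using assms
proof (induction "card E" arbitrary: E A rule: less_induct)
  case less
  have fin: "finite E" by (rule finite_subset[OF less.prems(1) finite_arcs])
  have "admissible_arc w S h \<nu> \<kappa> s (G\<lparr>arcs := E\<rparr>) e \<longleftrightarrow> e \<in> A" if e: "e \<in> E" for e
  proof -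
    let ?E = "E - {e}"
    obtain B where B: "solution ?E B" using solution_layers by blast
    have sub: "?E \<subseteq> arcs G" using less.prems by auto
    have "card ?E < card E" using e fin by (meson card_Diff1_less)
    then have adm: "admissible_arc w S h \<nu> \<kappa> s (G\<lparr>arcs := ?E\<rparr>) f \<longleftrightarrow> f \<in> B" for f
      using less.hyps[OF _ sub B] by blast
    have del: "pre_digraph.del_arc (G\<lparr>arcs := E\<rparr>) e = G\<lparr>arcs := ?E\<rparr>"
      by (simp add: pre_digraph.del_arc_def)
    have BE: "B \<subseteq> ?E" using B by (simp add: solution_def)
    have walk_in_B: "awalk s p u \<and> set p \<subseteq> ?E \<and> (\<forall>f\<in>set p. f \<in> B) \<and> R \<longleftrightarrow>
        awalk s p u \<and> set p \<subseteq> B \<and> R" for p u R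
      using BE by (meson subset_iff)
    have "admissible_arc w S h \<nu> \<kappa> s (G\<lparr>arcs := E\<rparr>) e \<longleftrightarrow>
        (\<exists>p. optimal_within B p (tail G e) \<and> usable e p)"
      using e fin BE
      by (subst admissible_arc.simps)
        (simp add: del adm awalk_restrict_arcs[OF sub] optimal_within_def usable_def
          walk_in_B walk_in_B[of _ _ True, simplified])
    also have "\<dots> \<longleftrightarrow> e \<in> A"
      using less.prems e optimal_within_delete_arc[OF less.prems(2) B]
      by (auto simp: solution_def)
    finally show ?thesis .
  qed
  moreover have "e \<in> E" if "admissible_arc w S h \<nu> \<kappa> s (G\<lparr>arcs := E\<rparr>) e" for e
    using that by (subst (asm) admissible_arc.simps) auto
  moreover have "A \<subseteq> E" using less.prems(2) by (simp add: solution_def)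
  ultimately show ?case by blast
qed

lemma optimal_admissible_walk_iff:
  assumes "solution (arcs G) A"
  shows "admissible_walk w S h \<nu> \<kappa> s G p v \<longleftrightarrow> awalk s p v \<and> set p \<subseteq> A"
    and "optimal_admissible_walk w S h \<nu> \<kappa> s G p v \<longleftrightarrow> optimal_within A p v"
proof -
  have "A = {e. admissible_arc w S h \<nu> \<kappa> s (G\<lparr>arcs := arcs G\<rparr>) e}"
    by (rule solution_eq_admissible[OF order_refl assms])
  also have "G\<lparr>arcs := arcs G\<rparr> = G" by (cases G) simp
  finally have "(\<forall>f\<in>set q. admissible_arc w S h \<nu> \<kappa> s G f) \<longleftrightarrow> set q \<subseteq> A" for q
    by blast
  then show "admissible_walk w S h \<nu> \<kappa> s G p v \<longleftrightarrow> awalk s p v \<and> set p \<subseteq> A"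
    and "optimal_admissible_walk w S h \<nu> \<kappa> s G p v \<longleftrightarrow> optimal_within A p v"
    by (simp_all add: admissible_walk_def optimal_admissible_walk_def optimal_within_def)
qed

end

section \<open>Invariants of the algorithm\<close>

locale scoped_network = road_network G w + scope_mapping G S \<nu> \<kappa>
  for G :: "('v, 'e) pre_digraph" and w S \<nu> \<kappa> +
  fixes s :: 'v
  assumes source_in_verts: "s \<in> verts G"
begin

section \<open>The effect of scanning one arc\<close>

abbreviation scan :: "'e \<Rightarrow> ('v, 'e) sd_state \<Rightarrow> ('v, 'e) sd_state" where
  "scan \<equiv> sd_scan_arc G w S \<nu> \<kappa> (\<lambda>_. \<infinity>)"

abbreviation usage :: "enat \<Rightarrow> 'e list \<Rightarrow> ereal" where
  "usage \<equiv> scope_usage w S (handicap G S) \<kappa>"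

definition scope_increment :: "'e \<Rightarrow> enat \<Rightarrow> ereal" where
  "scope_increment f i = (if S f > i then ereal (w f) else 0) +
     (if handicap G S f > i \<and> i \<ge> S f then \<kappa> i else 0)"

lemma usage_Nil [simp]: "usage i [] = 0"
  by (simp add: scope_usage_def)

text \<open>Usage is additive along a walk, so the scope vectors can be propagated arc by
  arc.\<close>

lemma usage_snoc [simp]: "usage i (p @ [f]) = usage i p + scope_increment f i"
  by (auto simp: scope_usage_def scope_increment_def ac_simps simp del: plus_ereal.simps)

definition open_arc :: "('v, 'e) sd_state \<Rightarrow> 'e \<Rightarrow> bool" where
  "open_arc st f \<longleftrightarrow> sig st (tail G f) (S f) \<le> \<nu> (S f)"

abbreviation new_dval :: "('v, 'e) sd_state \<Rightarrow> 'e \<Rightarrow> ereal" where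
  "new_dval st f \<equiv> dval st (tail G f) + ereal (w f)"

lemma dval_scan:
  "dval (scan f st) =
    (if open_arc st f \<and> new_dval st f < dval st (head G f)
     then (dval st)(head G f := new_dval st f) else dval st)"
  by (simp add: sd_scan_arc_def sd_relax_def open_arc_def Let_def)

lemma parc_scan:
  "parc (scan f st) =
    (if open_arc st f \<and> new_dval st f < dval st (head G f)
     then (parc st)(head G f := Some f) else parc st)"
  by (simp add: sd_scan_arc_def sd_relax_def open_arc_def Let_def)

lemma queue_scan:
  "queue (scan f st) =
    (if open_arc st f \<and> new_dval st f < dval st (head G f)
     then insert (head G f) (queue st) else queue st)"
  by (simp add: sd_scan_arc_def sd_relax_def open_arc_def Let_def)

text \<open>After the reset to infinity the minimum is just the new value. If a loop were strictly
  improved, that reset would also erase the vector read from its tail, whence the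
  assumption.\<close>

lemma sig_scan:
  assumes "tail G f \<noteq> head G f"
  shows "sig (scan f st) =
    (if open_arc st f \<and> new_dval st f < dval st (head G f)
     then (sig st)(head G f := \<lambda>i. sig st (tail G f) i + scope_increment f i)
     else if open_arc st f \<and> new_dval st f = dval st (head G f)
     then (sig st)(head G f :=
       \<lambda>i. min (sig st (head G f) i) (sig st (tail G f) i + scope_increment f i))
     else sig st)"
  using assms
  by (auto simp: sd_scan_arc_def sd_relax_def open_arc_def Let_def scope_increment_def min_def
      fun_eq_iff)

text \<open>With \<open>k\<close> levels, a successful test costs \<open>4 + k\<close>, a strict
  improvement \<open>3 + k\<close>, and the update of the vector \<open>k\<close>.\<close>

lemma time_scan: "time (scan f st) \<le> time st + (7 + 3 * real (card (levels G S)))"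
  by (simp add: sd_scan_arc_def sd_relax_def Let_def)

section \<open>The invariants and their preservation by scans\<close>

definition initial_time :: real where
  "initial_time = time (sd_init G S s)"

text \<open>
  \<open>F\<close> is the set of vertices removed from the queue, \<open>b\<close> separates their keys from all others, and
  \<open>A\<close> is the set of arcs scanned so far.
\<close>

definition search_invariant :: "'v set \<Rightarrow> ereal \<Rightarrow> 'e set \<Rightarrow> ('v, 'e) sd_state \<Rightarrow> bool" where
  "search_invariant F b A st \<longleftrightarrow>
     (\<forall>v. 0 \<le> dval st v) \<and> {v. dval st v \<noteq> \<infinity>} \<subseteq> verts G \<and>
     F \<subseteq> {v. dval st v \<noteq> \<infinity>} \<and> queue st = {v. dval st v \<noteq> \<infinity>} - F \<and>
     (\<forall>x\<in>F. dval st x \<le> b) \<and> (\<forall>y. y \<notin> F \<longrightarrow> b \<le> dval st y) \<and>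
     A \<subseteq> {f \<in> arcs G. tail G f \<in> F} \<and>
     time st \<le> initial_time + real (card F) * (1 + log 2 (real (card (verts G))))
       + real (card A) * (7 + 3 * real (card (levels G S)))"

text \<open>Openness is evaluated in the current state rather than at the time of the scan. With
  positive weights the two agree, since the labels of removed vertices are frozen.\<close>

definition relaxed :: "'e set \<Rightarrow> ('v, 'e) sd_state \<Rightarrow> 'e set" where
  "relaxed A st = {f \<in> A. open_arc st f}"

text \<open>The inequalities over relaxed arcs bound the labels by all walks; the walks show that
  the labels are attained. The walk may depend on the level, because the components of a scope
  vector are minimised independently.\<close>

definition label_invariant :: "'e set \<Rightarrow> ('v, 'e) sd_state \<Rightarrow> bool" where
  "label_invariant A st \<longleftrightarrow>
     dval st s = 0 \<and> (\<forall>i. sig st s i \<le> 0) \<and>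
     (\<forall>f\<in>relaxed A st. dval st (head G f) \<le> new_dval st f \<and>
        (dval st (head G f) = new_dval st f \<longrightarrow>
         (\<forall>i\<in>levels G S. sig st (head G f) i \<le> sig st (tail G f) i + scope_increment f i))) \<and>
     (\<forall>v. dval st v \<noteq> \<infinity> \<longrightarrow> (\<forall>i\<in>levels G S. \<exists>p. awalk s p v \<and> set p \<subseteq> relaxed A st \<and>
        dval st v = ereal (awalk_cost w p) \<and> sig st v i = usage i p)) \<and>
     (\<forall>v. dval st v \<noteq> \<infinity> \<longrightarrow> v = s \<and> parc st v = None \<or>
        (\<exists>f\<in>relaxed A st. parc st v = Some f \<and> head G f = v \<and> dval st v = new_dval st f))"

definition positive_weights :: bool where
  "positive_weights \<longleftrightarrow> (\<forall>e\<in>arcs G. 0 < w e)"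

text \<open>A new key is at least \<open>b\<close>, so it cannot strictly improve a vertex of
  \<open>F\<close>. Nonnegative weights suffice for this, and hence for termination and the time
  bound.\<close>

lemma scan_search_invariant:
  assumes inv: "search_invariant F b A st"
    and f: "f \<in> arcs G" "f \<notin> A" "tail G f \<in> F" "dval st (tail G f) = b"
  shows "search_invariant F b (insert f A) (scan f st)"
    and "\<And>x. x \<in> F \<Longrightarrow> dval (scan f st) x = dval st x"
proof -
  have nonneg: "\<And>v. 0 \<le> dval st v" and b: "0 \<le> b" "b \<noteq> \<infinity>"
    using inv f by (auto simp: search_invariant_def)
  have ge: "b \<le> new_dval st f"
    using f weight_nonneg[OF f(1)] by (simp add: ereal_le_add_self)
  have head_F: "head G f \<notin> F" if "new_dval st f < dval st (head G f)"
    using that ge inv by (auto simp: search_invariant_def)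
  show unchanged: "dval (scan f st) x = dval st x" if "x \<in> F" for x
    using head_F that by (auto simp: dval_scan)
  have "A \<subseteq> arcs G" using inv by (auto simp: search_invariant_def)
  then have "finite A" using finite_subset finite_arcs by blast
  then have "real (card (insert f A)) = real (card A) + 1" using f by simp
  then have "time (scan f st) \<le>
      initial_time + real (card F) * (1 + log 2 (real (card (verts G))))
       + real (card (insert f A)) * (7 + 3 * real (card (levels G S)))"
    using time_scan[of f st] inv by (simp add: search_invariant_def algebra_simps)
  moreover have "0 \<le> dval (scan f st) v" for v
    using nonneg ge b by (auto simp: dval_scan intro: order_trans)
  moreover have fin: "{v. dval (scan f st) v \<noteq> \<infinity>} =
      (if open_arc st f \<and> new_dval st f < dval st (head G f)
       then insert (head G f) {v. dval st v \<noteq> \<infinity>} else {v. dval st v \<noteq> \<infinity>})"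
    using f b by (auto simp: dval_scan)
  moreover have "b \<le> dval (scan f st) y" if "y \<notin> F" for y
    using inv ge that by (auto simp: search_invariant_def dval_scan)
  moreover have "queue (scan f st) = {v. dval (scan f st) v \<noteq> \<infinity>} - F"
    unfolding fin queue_scan using inv head_F by (auto simp: search_invariant_def)
  ultimately show "search_invariant F b (insert f A) (scan f st)"
    using inv f(1,3) unchanged unfolding search_invariant_def by (auto split: if_splits)
qed

text \<open>Positive weights push the new key strictly above \<open>b\<close>, so even a tie cannot
  touch a vertex of \<open>F\<close>. Through a zero-weight arc, a tie could alter the scope vector
  of a vertex whose arcs have already been scanned.\<close>

lemma scan_label_invariant:
  assumes inv: "search_invariant F b A st" "label_invariant A st"
    and f: "f \<in> arcs G" "f \<notin> A" "tail G f \<in> F" "dval st (tail G f) = b"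
    and pos: positive_weights
  shows "label_invariant (insert f A) (scan f st)"
proof -
  let ?st = "scan f st" and ?u = "tail G f" and ?v = "head G f"
  have wf: "0 < w f" using pos f by (simp add: positive_weights_def)
  have b: "0 \<le> b" "b \<noteq> \<infinity>" using inv f by (auto simp: search_invariant_def)
  have gt: "b < new_dval st f"
    using f b wf by (cases b) auto
  have head_F: "?v \<notin> F" if "new_dval st f \<le> dval st ?v"
    using that gt inv(1) by (force simp: search_invariant_def)
  show ?thesis
  proof (cases "open_arc st f \<and> new_dval st f \<le> dval st ?v")
    case False
    have uv: "dval ?st = dval st" "parc ?st = parc st"
      using False by (auto simp: dval_scan parc_scan)
    have sg: "sig ?st = sig st"
      using False by (auto simp: sd_scan_arc_def sd_relax_def open_arc_def Let_def)
    have "open_arc ?st = open_arc st" by (simp add: open_arc_def sg fun_eq_iff)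
    then have "relaxed (insert f A) ?st = (if open_arc st f then insert f (relaxed A st) else relaxed A st)"
      by (auto simp: relaxed_def)
    then have rel: "relaxed A st \<subseteq> relaxed (insert f A) ?st"
      "\<And>g. g \<in> relaxed (insert f A) ?st \<Longrightarrow> g = f \<and> open_arc st f \<or> g \<in> relaxed A st"
      by (auto split: if_splits)
    have src: "dval st s = 0 \<and> (\<forall>i. sig st s i \<le> 0)"
      using inv(2) by (simp add: label_invariant_def)
    have arcs_ok: "dval st (head G g) \<le> new_dval st g \<and>
        (dval st (head G g) = new_dval st g \<longrightarrow>
         (\<forall>i\<in>levels G S. sig st (head G g) i \<le> sig st (tail G g) i + scope_increment g i))"
      if g: "g \<in> relaxed (insert f A) ?st" for g
    proof (cases "g \<in> relaxed A st")
      case True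
      then show ?thesis using inv(2) by (simp add: label_invariant_def)
    next
      case False
      \<comment> \<open>The new arc is open but changes nothing, so its inequality is strict and the
        tie condition is vacuous.\<close>
      then have "dval st ?v < new_dval st f" "g = f"
        using rel(2)[OF g] \<open>\<not> (open_arc st f \<and> _)\<close> by auto
      then show ?thesis by auto
    qed
    have walks: "\<exists>p. awalk s p x \<and> set p \<subseteq> relaxed (insert f A) ?st \<and>
        dval st x = ereal (awalk_cost w p) \<and> sig st x i = usage i p"
      if "dval st x \<noteq> \<infinity>" "i \<in> levels G S" for x i
      using inv(2) that rel(1) unfolding label_invariant_def by (meson order_trans)
    have parcs: "x = s \<and> parc st x = None \<or>
        (\<exists>g\<in>relaxed (insert f A) ?st. parc st x = Some g \<and> head G g = x \<and>
           dval st x = new_dval st g)"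
      if "dval st x \<noteq> \<infinity>" for x
      using inv(2) that rel(1) unfolding label_invariant_def by (meson subsetD)
    show ?thesis
      unfolding label_invariant_def uv sg using src arcs_ok walks parcs by blast
  next
    case True
    then have vF: "?v \<notin> F" using head_F by blast
    then have neq: "?u \<noteq> ?v" using f by auto
    have d_F: "dval ?st x = dval st x" if "x \<noteq> ?v" for x
      using that by (simp add: dval_scan)
    have s_F: "sig ?st x = sig st x" if "x \<noteq> ?v" for x
      using that by (simp add: sig_scan[OF neq])
    have dv: "dval ?st ?v = new_dval st f" using True by (auto simp: dval_scan)
    have sv: "sig ?st ?v i \<le> sig st ?u i + scope_increment f i" for i
      using True by (auto simp: sig_scan[OF neq])
    have tails: "tail G g \<noteq> ?v" if "g \<in> insert f A" for g
      using that vF inv(1) f by (auto simp: search_invariant_def)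
    then have open_eq: "open_arc ?st g \<longleftrightarrow> open_arc st g" if "g \<in> insert f A" for g
      using that s_F by (simp add: open_arc_def)
    then have rel: "relaxed (insert f A) ?st = insert f (relaxed A st)"
      using True by (auto simp: relaxed_def)
    have relA: "relaxed A st \<subseteq> A" by (auto simp: relaxed_def)
    have "s \<noteq> ?v"
      using True gt b inv(2) by (auto simp: label_invariant_def)
    then have src: "dval ?st s = 0 \<and> (\<forall>i. sig ?st s i \<le> 0)"
      using inv(2) by (simp add: label_invariant_def d_F s_F)
    have arcs_ok: "dval ?st (head G g) \<le> new_dval ?st g \<and>
        (dval ?st (head G g) = new_dval ?st g \<longrightarrow>
         (\<forall>i\<in>levels G S. sig ?st (head G g) i \<le> sig ?st (tail G g) i + scope_increment g i))"
      if g: "g \<in> insert f (relaxed A st)" for g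
    proof (cases "g = f")
      case True
      then show ?thesis using d_F[OF neq] s_F[OF neq] dv sv by simp
    next
      case False
      then have gr: "g \<in> relaxed A st" using g by simp
      then have tg: "tail G g \<noteq> ?v" using tails relA by blast
      have old: "dval st (head G g) \<le> new_dval st g"
        "dval st (head G g) = new_dval st g \<Longrightarrow> i \<in> levels G S \<Longrightarrow>
          sig st (head G g) i \<le> sig st (tail G g) i + scope_increment g i" for i
        using inv(2) gr by (auto simp: label_invariant_def)
      show ?thesis
      \<comment> \<open>An earlier arc into the same head: a strict improvement makes its inequality
        strict, and a tie can only decrease the scope vector.\<close>
      proof (cases "head G g = ?v")
        case hd: True
        show ?thesis
        proof (cases "new_dval st f < dval st ?v")
          case True
          then have "dval ?st (head G g) < new_dval ?st g"
            using old(1) dv d_F[OF tg] hd by (auto intro: less_le_trans)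
          then show ?thesis by auto
        next
          case False
          then have eq: "new_dval st f = dval st ?v" using True \<open>open_arc st f \<and> _\<close> by auto
          then have "sig ?st ?v i \<le> sig st ?v i" for i
            using \<open>open_arc st f \<and> _\<close> by (simp add: sig_scan[OF neq])
          then show ?thesis
            using old dv eq hd d_F[OF tg] s_F[OF tg] by (auto intro: order_trans)
        qed
      next
        case False
        then show ?thesis using old d_F s_F tg by auto
      qed
    qed
    have old_walk: "\<exists>p. awalk s p x \<and> set p \<subseteq> relaxed A st \<and>
        dval st x = ereal (awalk_cost w p) \<and> sig st x i = usage i p"
      if "dval st x \<noteq> \<infinity>" "i \<in> levels G S" for x i
      using inv(2) that by (simp add: label_invariant_def)
    have walks: "\<exists>p. awalk s p x \<and> set p \<subseteq> insert f (relaxed A st) \<and>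
        dval ?st x = ereal (awalk_cost w p) \<and> sig ?st x i = usage i p"
      if x: "dval ?st x \<noteq> \<infinity>" and i: "i \<in> levels G S" for x i
    \<comment> \<open>For each level the stored value either extends a value of the tail by
      \<open>f\<close> or is unchanged; in the latter case a strict improvement of \<open>x\<close>
      is impossible.\<close>
    proof (cases "x = ?v \<and> sig ?st x i = sig st ?u i + scope_increment f i")
      case True
      obtain p where p: "awalk s p ?u" "set p \<subseteq> relaxed A st"
        "dval st ?u = ereal (awalk_cost w p)" "sig st ?u i = usage i p"
        using old_walk[OF _ i, of ?u] f b by auto
      have "awalk s (p @ [f]) ?v"
        using p(1) f(1) by (auto simp: awalk_append_iff awalk_Cons_iff awalk_Nil_iff)
      moreover have "set (p @ [f]) \<subseteq> insert f (relaxed A st)" using p(2) by auto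
      moreover have "dval ?st ?v = ereal (awalk_cost w (p @ [f]))" using dv p(3) by simp
      moreover have "sig ?st ?v i = usage i (p @ [f])" using True p(4) by auto
      ultimately show ?thesis unfolding conjunct1[OF True] by blast
    next
      case no_step: False
      have "dval ?st x = dval st x \<and> sig ?st x i = sig st x i"
      proof (cases "x = ?v")
        case True
        then show ?thesis
          using no_step \<open>open_arc st f \<and> _\<close>
          by (auto simp: sig_scan[OF neq] dval_scan min_def split: if_splits)
      qed (simp add: d_F s_F)
      then show ?thesis using old_walk[of x i] x i by auto
    qed
    have parcs: "x = s \<and> parc ?st x = None \<or>
        (\<exists>g\<in>insert f (relaxed A st). parc ?st x = Some g \<and> head G g = x \<and>
           dval ?st x = new_dval ?st g)"
      if x: "dval ?st x \<noteq> \<infinity>" for x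
    proof (cases "x = ?v \<and> new_dval st f < dval st ?v")
      case True
      then show ?thesis
        using \<open>open_arc st f \<and> _\<close> dv d_F[OF neq] by (auto simp: parc_scan)
    next
      case False
      then have same: "parc ?st x = parc st x" "dval ?st x = dval st x"
        by (auto simp: parc_scan dval_scan)
      have "x = s \<and> parc st x = None \<or>
        (\<exists>g\<in>relaxed A st. parc st x = Some g \<and> head G g = x \<and> dval st x = new_dval st g)"
        using inv(2) x same by (simp add: label_invariant_def)
      then show ?thesis using same d_F tails relA by (metis insertCI subsetD)
    qed
    show ?thesis
      unfolding label_invariant_def rel using src arcs_ok walks parcs by blast
  qed
qed

lemma fold_scan_invariants:
  assumes "search_invariant F b A st" "positive_weights \<longrightarrow> label_invariant A st"
    and "u \<in> F" "dval st u = b" "distinct fs" "set fs \<subseteq> out_arcs G u" "set fs \<inter> A = {}"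
  shows "search_invariant F b (A \<union> set fs) (fold scan fs st) \<and>
    (positive_weights \<longrightarrow> label_invariant (A \<union> set fs) (fold scan fs st))"
  using assms
proof (induction fs arbitrary: A st)
  case (Cons f fs)
  have f: "f \<in> arcs G" "f \<notin> A" "tail G f \<in> F" "dval st (tail G f) = b"
    using Cons.prems by (auto simp: out_arcs_def)
  note inv = scan_search_invariant[OF Cons.prems(1) f]
  have "positive_weights \<longrightarrow> label_invariant (insert f A) (scan f st)"
    using scan_label_invariant[OF Cons.prems(1) _ f] Cons.prems(2) by blast
  then have "search_invariant F b (insert f A \<union> set fs) (fold scan fs (scan f st)) \<and>
    (positive_weights \<longrightarrow> label_invariant (insert f A \<union> set fs) (fold scan fs (scan f st)))"
    using Cons.prems inv by (intro Cons.IH) auto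
  then show ?case by simp
qed simp

section \<open>Runs and termination\<close>

text \<open>The number \<open>n\<close> counts iterations. Each removes a new vertex for good, so it
  is at most the number of vertices, which bounds the length of every run.\<close>

definition reach_invariant :: "nat \<Rightarrow> ('v, 'e) sd_state \<Rightarrow> bool" where
  "reach_invariant n st \<longleftrightarrow> (\<exists>F b. card F = n \<and>
     search_invariant F b {f \<in> arcs G. tail G f \<in> F} st \<and>
     (positive_weights \<longrightarrow> label_invariant {f \<in> arcs G. tail G f \<in> F} st))"

lemma reach_invariant_init: "reach_invariant 0 (sd_init G S s)"
proof -
  have "search_invariant {} 0 {} (sd_init G S s)"
    using source_in_verts by (auto simp: search_invariant_def initial_time_def sd_init_def)
  moreover have "label_invariant {} (sd_init G S s)"
    using source_in_verts
    by (auto simp: label_invariant_def sd_init_def relaxed_def awalk_Nil_iff intro!: exI[of _ "[]"])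
  ultimately show ?thesis
    unfolding reach_invariant_def by (intro exI[of _ "{}"] exI[of _ 0]) auto
qed

lemma reach_invariant_step:
  assumes "reach_invariant n st" "sd_step G w S \<nu> \<kappa> (\<lambda>_. \<infinity>) st st'"
  shows "reach_invariant (Suc n) st'"
proof -
  obtain F b where F: "card F = n"
    and inv: "search_invariant F b {f \<in> arcs G. tail G f \<in> F} st"
      "positive_weights \<longrightarrow> label_invariant {f \<in> arcs G. tail G f \<in> F} st"
    using assms(1) by (auto simp: reach_invariant_def)
  obtain u fs where u: "u \<in> queue st" "\<And>x. x \<in> queue st \<Longrightarrow> dval st u \<le> dval st x"
    and fs: "distinct fs" "set fs = out_arcs G u"
    and st': "st' = fold scan fs (st\<lparr>queue := queue st - {u},
             time := time st + 1 + log 2 (real (card (queue st)))\<rparr>)"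
    using assms(2) by (auto simp: sd_step_def)
  let ?F = "insert u F" and ?A = "{f \<in> arcs G. tail G f \<in> F}"
  let ?st = "st\<lparr>queue := queue st - {u}, time := time st + 1 + log 2 (real (card (queue st)))\<rparr>"
  have "F \<subseteq> verts G" and q: "queue st \<subseteq> verts G" and uF: "u \<notin> F"
    using inv(1) u(1) by (auto simp: search_invariant_def)
  then have finF: "finite F" using finite_subset finite_verts by blast
  then have card: "card ?F = Suc n" using uF F by simp
  have "card (queue st) > 0"
    using u(1) q finite_subset[OF q finite_verts] by (auto simp: card_gt_0_iff)
  moreover have "card (queue st) \<le> card (verts G)" using q by (simp add: card_mono)
  ultimately have "log 2 (real (card (queue st))) \<le> log 2 (real (card (verts G)))"
    by simp
  then have "time ?st \<le> initial_time + real (card ?F) * (1 + log 2 (real (card (verts G))))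
       + real (card ?A) * (7 + 3 * real (card (levels G S)))"
    using inv(1) F card by (simp add: search_invariant_def algebra_simps)
  \<comment> \<open>The removed key becomes the new separator: remaining vertices are either in the
    queue, where \<open>u\<close> is minimal, or still at infinity.\<close>
  moreover have "dval st u \<le> dval st y" if "y \<notin> ?F" for y
    using that inv(1) u(2)[of y] by (cases "dval st y = \<infinity>") (auto simp: search_invariant_def)
  moreover have "dval st x \<le> dval st u" if "x \<in> ?F" for x
    using that inv(1) uF unfolding search_invariant_def by (metis insertE order_refl order_trans)
  moreover have "dval st u \<noteq> \<infinity>" using inv(1) u(1) by (auto simp: search_invariant_def)
  ultimately have "search_invariant ?F (dval st u) ?A ?st"
    using inv(1) unfolding search_invariant_def by auto
  moreover have "label_invariant ?A ?st" if positive_weights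
    using inv(2) that by (simp add: label_invariant_def relaxed_def open_arc_def)
  ultimately have inv': "search_invariant ?F (dval st u) (?A \<union> set fs) (fold scan fs ?st) \<and>
      (positive_weights \<longrightarrow> label_invariant (?A \<union> set fs) (fold scan fs ?st))"
    by (intro fold_scan_invariants) (use fs uF in \<open>auto simp: out_arcs_def\<close>)
  have "?A \<union> set fs = {f \<in> arcs G. tail G f \<in> ?F}"
    using fs by (auto simp: out_arcs_def)
  from inv'[unfolded this] show ?thesis unfolding reach_invariant_def st' using card by blast
qed

lemma reachable_invariant:
  assumes "sd_reachable G w S \<nu> \<kappa> (\<lambda>_. \<infinity>) s st"
  obtains n where "reach_invariant n st"
proof -
  have "\<exists>n. reach_invariant n st"
    using assms
    by (induction rule: rtranclp_induct) (use reach_invariant_init reach_invariant_step in blast)+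
  then show thesis using that by blast
qed

lemma reach_invariant_le: "reach_invariant n st \<Longrightarrow> n \<le> card (verts G)"
  unfolding reach_invariant_def search_invariant_def
  by (metis (no_types, lifting) card_mono finite_verts order_trans)

lemma terminates: "sd_terminates G w S \<nu> \<kappa> (\<lambda>_. \<infinity>) s"
  unfolding sd_terminates_def
proof (intro conjI allI impI notI)
  assume "\<exists>run. run 0 = sd_init G S s \<and>
    (\<forall>i::nat. sd_step G w S \<nu> \<kappa> (\<lambda>_. \<infinity>) (run i) (run (Suc i)))"
  then obtain run where run: "run 0 = sd_init G S s"
    "\<And>i::nat. sd_step G w S \<nu> \<kappa> (\<lambda>_. \<infinity>) (run i) (run (Suc i))" by blast
  have "reach_invariant i (run i)" for i
    by (induction i) (auto simp: run(1) reach_invariant_init intro: reach_invariant_step run(2))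
  from reach_invariant_le[OF this[of "Suc (card (verts G))"]] show False by simp
next
  fix st assume st: "sd_reachable G w S \<nu> \<kappa> (\<lambda>_. \<infinity>) s st \<and> queue st \<noteq> {}"
  then obtain n where "reach_invariant n st" using reachable_invariant by blast
  then have "queue st \<subseteq> verts G" by (auto simp: reach_invariant_def search_invariant_def)
  then have "finite (queue st)" using finite_subset finite_verts by blast
  then obtain u where "is_arg_min (dval st) (\<lambda>x. x \<in> queue st) u"
    using ex_is_arg_min_if_finite st by blast
  then have u: "u \<in> queue st" "\<forall>x\<in>queue st. dval st u \<le> dval st x"
    by (auto simp: is_arg_min_linorder)
  have "finite (out_arcs G u)" by (simp add: out_arcs_def)
  then obtain fs where "distinct fs" "set fs = out_arcs G u"
    using finite_distinct_list by blast
  then show "\<exists>st'. sd_step G w S \<nu> \<kappa> (\<lambda>_. \<infinity>) st st'" using u by (auto simp: sd_step_def)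
qed

section \<open>The running time\<close>

text \<open>Since \<open>0\<close> and \<open>\<infinity>\<close> are both levels,
  \<open>2 \<le> L \<le> E\<close>, so all terms in \<open>E\<close> and \<open>L\<close> are
  absorbed by \<open>E * L\<close>. The constant 20 is generous.\<close>

lemma time_bound:
  assumes "sd_reachable G w S \<nu> \<kappa> (\<lambda>_. \<infinity>) s st"
  shows "time st \<le> 20 * (real (card (arcs G)) * real (card (levels G S))
           + real (card (verts G)) * log 2 (real (card (verts G))))"
proof -
  define E V L where "E = real (card (arcs G))" and "V = real (card (verts G))"
    and "L = real (card (levels G S))"
  obtain n where reach_n: "reach_invariant n st" using reachable_invariant[OF assms] .
  then obtain F b where inv: "search_invariant F b {f \<in> arcs G. tail G f \<in> F} st"
    using reach_n by (auto simp: reach_invariant_def)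
  have "card {0, \<infinity>::enat} \<le> card (levels G S)"
    using zero_level infinite_level by (intro card_mono) (auto simp: levels_def)
  then have L: "2 \<le> L" by (simp add: L_def)
  have "L \<le> E" by (simp add: L_def E_def levels_def card_image_le)
  then have E: "2 \<le> E" using L by simp
  have "card (verts G) > 0" using source_in_verts by (auto simp: card_gt_0_iff)
  then have V: "1 \<le> V" by (simp add: V_def)
  then have logV: "0 \<le> log 2 V" by simp
  have "F \<subseteq> verts G" using inv by (auto simp: search_invariant_def)
  then have "real (card F) \<le> V" by (simp add: V_def card_mono)
  moreover have "real (card {f \<in> arcs G. tail G f \<in> F}) \<le> E"
    by (simp add: E_def card_mono)
  moreover have "time st \<le> initial_time + real (card F) * (1 + log 2 V)
       + real (card {f \<in> arcs G. tail G f \<in> F}) * (7 + 3 * L)"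
    using inv by (simp add: search_invariant_def V_def L_def)
  moreover have "initial_time = 3 * V + 2 * L + 1 + E * (2 + L)"
    by (simp add: initial_time_def sd_init_def E_def V_def L_def)
  ultimately have "time st \<le> 3 * V + 2 * L + 1 + E * (2 + L) + V * (1 + log 2 V) + E * (7 + 3 * L)"
    using logV L by (smt (verit) mult_right_mono)
  also have "\<dots> = 4 * V + (2 * L + 1) + 9 * E + 4 * (E * L) + V * log 2 V"
    by (simp add: algebra_simps)
  also have "\<dots> \<le> 20 * (E * L + V * log 2 V)"
  proof -
    have EL: "2 * L \<le> E * L" "2 * E \<le> E * L" using E L by auto
    \<comment> \<open>The graph need not be connected, so a linear term in \<open>V\<close> is
      absorbed by \<open>V * log 2 V\<close>, except for a single vertex, where the logarithm
      vanishes and \<open>E * L\<close> takes over.\<close>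
    have "V \<le> E * L + V * log 2 V"
    proof (cases "card (verts G) = 1")
      case False
      then have "2 \<le> V" using V by (simp add: V_def)
      then have "1 \<le> log 2 V" by (simp add: le_log_iff)
      then have "V * 1 \<le> V * log 2 V" using V by (intro mult_left_mono) auto
      moreover have "0 \<le> E * L" using E L by simp
      ultimately show ?thesis by simp
    next
      case True
      moreover have "4 \<le> E * L" using mult_mono[of 2 E 2 L] E L by simp
      ultimately show ?thesis by (simp add: V_def)
    qed
    moreover have "0 \<le> V * log 2 V" using V logV by simp
    ultimately show ?thesis using EL L E by argo
  qed
  finally show ?thesis by (simp add: E_def V_def L_def)
qed

section \<open>Correctness of the final labels and of the walks read off\<close>

text \<open>Chains the inequalities over relaxed arcs. The bound on scope vectors holds only at
  tight arcs, but a walk whose cost equals the label at its end is tight at every arc.\<close>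

lemma label_le_walk:
  assumes lab: "label_invariant A st" and p: "awalk s p v" "set p \<subseteq> relaxed A st"
  shows "dval st v \<le> ereal (awalk_cost w p) \<and>
    (dval st v = ereal (awalk_cost w p) \<longrightarrow> (\<forall>i\<in>levels G S. sig st v i \<le> usage i p))"
  using p
proof (induction p arbitrary: v rule: rev_induct)
  case Nil
  then have "v = s" by (simp add: awalk_Nil_iff)
  moreover have "dval st s = 0" "sig st s i \<le> 0" for i
    using lab by (simp_all add: label_invariant_def)
  ultimately show ?case by (simp flip: zero_ereal_def)
next
  case (snoc f p)
  have v: "head G f = v" and p: "awalk s p (tail G f)" "set p \<subseteq> relaxed A st"
    and f: "f \<in> relaxed A st"
    using snoc.prems by (auto simp: awalk_append_iff awalk_Cons_iff awalk_Nil_iff)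
  note IH = snoc.IH[OF p]
  have arc: "dval st v \<le> new_dval st f"
    "dval st v = new_dval st f \<Longrightarrow> i \<in> levels G S \<Longrightarrow>
      sig st v i \<le> sig st (tail G f) i + scope_increment f i" for i
    using lab f v by (auto simp: label_invariant_def)
  have step: "new_dval st f \<le> ereal (awalk_cost w (p @ [f]))"
    using IH by (cases "dval st (tail G f)") auto
  have "sig st v i \<le> usage i (p @ [f])"
    if eq: "dval st v = ereal (awalk_cost w (p @ [f]))" and i: "i \<in> levels G S" for i
  proof -
    have "new_dval st f = ereal (awalk_cost w (p @ [f]))" using arc(1) step eq by auto
    then have "dval st (tail G f) = ereal (awalk_cost w p)"
      by (cases "dval st (tail G f)") auto
    then have "sig st (tail G f) i \<le> usage i p" using IH i by blast
    moreover have "sig st v i \<le> sig st (tail G f) i + scope_increment f i"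
      using arc(2) i eq \<open>new_dval st f = _\<close> by simp
    ultimately show ?thesis by (simp add: add_right_mono order_trans[OF _ add_right_mono])
  qed
  then show ?case using arc(1) step by (auto intro: order_trans)
qed

text \<open>Positive weights make keys strictly decrease along predecessors, so following them
  cannot cycle; the induction counts the vertices of smaller key.\<close>

lemma read_off_walk:
  assumes lab: "label_invariant A st" and inv: "search_invariant F b A st"
    and pos: positive_weights and v: "dval st v \<noteq> \<infinity>"
  shows "\<exists>p. read_off G (parc st) v p \<and> awalk s p v \<and> set p \<subseteq> relaxed A st \<and>
    dval st v = ereal (awalk_cost w p)"
  using v
proof (induction "card {x. dval st x < dval st v}" arbitrary: v rule: less_induct)
  case less
  have fin: "finite {x. dval st x < dval st v}"
    by (rule finite_subset[OF _ finite_verts]) (use inv in \<open>auto simp: search_invariant_def\<close>)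
  consider "v = s" "parc st v = None"
    | f where "f \<in> relaxed A st" "parc st v = Some f" "head G f = v" "dval st v = new_dval st f"
    using lab less.prems by (auto simp: label_invariant_def)
  then show ?case
  proof cases
    case 1
    then have "read_off G (parc st) v []" by (simp add: read_off.intros)
    then show ?thesis
      using 1 lab source_in_verts
      by (intro exI[of _ "[]"]) (auto simp: awalk_Nil_iff label_invariant_def)
  next
    case 2
    have f: "f \<in> arcs G" using 2(1) inv by (auto simp: relaxed_def search_invariant_def)
    then have "0 < w f" using pos by (simp add: positive_weights_def)
    moreover have u: "dval st (tail G f) \<noteq> \<infinity>" using less.prems 2(4) by auto
    moreover have "0 \<le> dval st (tail G f)" using inv by (simp add: search_invariant_def)
    ultimately have "dval st (tail G f) < dval st v"
      using 2(4) by (cases "dval st (tail G f)") auto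
    then have "{x. dval st x < dval st (tail G f)} \<subset> {x. dval st x < dval st v}" by auto
    then obtain p where p: "read_off G (parc st) (tail G f) p" "awalk s p (tail G f)"
      "set p \<subseteq> relaxed A st" "dval st (tail G f) = ereal (awalk_cost w p)"
      using less.hyps[OF psubset_card_mono[OF fin] u] by blast
    have "awalk s (p @ [f]) v"
      using p(2) f 2(3) by (auto simp: awalk_append_iff awalk_Cons_iff awalk_Nil_iff)
    then show ?thesis
      using p 2 by (intro exI[of _ "p @ [f]"]) (auto intro: read_off.intros)
  qed
qed

lemma final_state_correct:
  assumes reach: "sd_reachable G w S \<nu> \<kappa> (\<lambda>_. \<infinity>) s st" and empty: "queue st = {}"
    and pos: positive_weights
  shows "(\<exists>p. dval st v = ereal (awalk_cost w p) \<and> read_off G (parc st) v p \<and>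
       optimal_admissible_walk w S (handicap G S) \<nu> \<kappa> s G p v) \<or>
     (dval st v = \<infinity> \<and> (\<nexists>p. admissible_walk w S (handicap G S) \<nu> \<kappa> s G p v))"
proof -
  interpret positive_network G w S "handicap G S" \<nu> \<kappa> s
    using pos by unfold_locales (simp add: positive_weights_def)
  obtain n where reach_n: "reach_invariant n st" using reachable_invariant[OF reach] .
  then obtain F b where inv: "search_invariant F b {f \<in> arcs G. tail G f \<in> F} st"
    and lab: "label_invariant {f \<in> arcs G. tail G f \<in> F} st"
    using reach_n pos by (auto simp: reach_invariant_def)
  let ?A = "{f \<in> arcs G. tail G f \<in> F}"
  let ?R = "relaxed ?A st"
  \<comment> \<open>With an empty queue every reached vertex has been removed, so all arcs leaving
    reached vertices have been scanned.\<close>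
  have F: "F = {x. dval st x \<noteq> \<infinity>}" using inv empty by (auto simp: search_invariant_def)
  note below = label_le_walk[OF lab]
  have walk: "\<exists>p. optimal_within ?R p x \<and> dval st x = ereal (awalk_cost w p) \<and> sig st x i = usage i p"
    if "dval st x \<noteq> \<infinity>" "i \<in> levels G S" for x i
  proof -
    obtain p where p: "awalk s p x" "set p \<subseteq> ?R"
        "dval st x = ereal (awalk_cost w p)" "sig st x i = usage i p"
      using lab \<open>dval st x \<noteq> \<infinity>\<close> \<open>i \<in> levels G S\<close> unfolding label_invariant_def by blast
    have "awalk_cost w p \<le> awalk_cost w q" if "awalk s q x" "set q \<subseteq> ?R" for q
      using below[OF that] p(3) by simp
    then show ?thesis using p by (auto simp: optimal_within_def)
  qed
  have sol: "solution (arcs G) ?R"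
    unfolding solution_def
  proof (intro conjI ballI iffI)
    show "?R \<subseteq> arcs G" by (auto simp: relaxed_def)
  next
    fix e assume e: "e \<in> arcs G" "e \<in> ?R"
    then have "dval st (tail G e) \<noteq> \<infinity>" "open_arc st e" using F by (auto simp: relaxed_def)
    moreover have "S e \<in> levels G S" using e by (simp add: levels_def)
    ultimately show "\<exists>p. optimal_within ?R p (tail G e) \<and> usable e p"
      \<comment> \<open>The optimal walk attaining the component at level \<open>S e\<close> is the
        witness: the test on \<open>e\<close> is exactly its usability.\<close>
      using walk[of "tail G e" "S e"] by (auto simp: usable_def open_arc_def)
  next
    fix e assume e: "e \<in> arcs G"
      and "\<exists>p. optimal_within ?R p (tail G e) \<and> usable e p"
    then obtain p where p: "optimal_within ?R p (tail G e)" "usable e p" by blast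
    have lev: "S e \<in> levels G S" using e by (simp add: levels_def)
    have pw: "awalk s p (tail G e)" "set p \<subseteq> ?R" using p by (auto simp: optimal_within_def)
    then have fin: "dval st (tail G e) \<noteq> \<infinity>" using below[OF pw] by auto
    then obtain q where q: "optimal_within ?R q (tail G e)"
        "dval st (tail G e) = ereal (awalk_cost w q)"
      using walk lev by blast
    \<comment> \<open>Optimal walks have equal cost, so \<open>p\<close> attains the label too and
      its usage bounds the scope vector from above.\<close>
    then have "dval st (tail G e) = ereal (awalk_cost w p)"
      using p(1) by (auto simp: optimal_within_def intro: antisym)
    then have "sig st (tail G e) (S e) \<le> usage (S e) p" using below[OF pw] lev by blast
    then have "open_arc st e" using p(2) by (auto simp: usable_def open_arc_def)
    then show "e \<in> ?R" using e fin F by (simp add: relaxed_def)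
  qed
  show ?thesis
  proof (cases "dval st v = \<infinity>")
    case True
    have "\<not> admissible_walk w S (handicap G S) \<nu> \<kappa> s G p v" for p
      using below[of p v] True by (auto simp: optimal_admissible_walk_iff(1)[OF sol])
    then show ?thesis using True by blast
  next
    case False
    obtain p where p: "read_off G (parc st) v p" "awalk s p v" "set p \<subseteq> ?R"
      "dval st v = ereal (awalk_cost w p)"
      using read_off_walk[OF lab inv pos False] by blast
    have "awalk_cost w p \<le> awalk_cost w q" if "awalk s q v" "set q \<subseteq> ?R" for q
      using below[OF that] p(4) by simp
    then have "optimal_within ?R p v" using p by (simp add: optimal_within_def)
    then have "optimal_admissible_walk w S (handicap G S) \<nu> \<kappa> s G p v"
      by (simp add: optimal_admissible_walk_iff(2)[OF sol])
    then show ?thesis using p(1,4) by blast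
  qed
qed

end

theorem theorem2:
  "\<exists>C::real. \<forall>(G :: ('v, 'e) pre_digraph) w S \<nu> \<kappa> s.
     road_network G w \<and> scope_mapping G S \<nu> \<kappa> \<and> s \<in> verts G \<longrightarrow>
     sd_terminates G w S \<nu> \<kappa> (\<lambda>_. \<infinity>) s \<and>
     (\<forall>st. sd_reachable G w S \<nu> \<kappa> (\<lambda>_. \<infinity>) s st \<and> queue st = {} \<longrightarrow>
        time st \<le> C * (real (card (arcs G)) * real (card (levels G S))
                       + real (card (verts G)) * log 2 (real (card (verts G)))) \<and>
        ((\<forall>e\<in>arcs G. 0 < w e) \<longrightarrow>
         (\<forall>v\<in>verts G.
            (\<exists>p. dval st v = ereal (wf_digraph.awalk_cost w p) \<and> read_off G (parc st) v p \<and>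
                 optimal_admissible_walk w S (handicap G S) \<nu> \<kappa> s G p v) \<or>
            (dval st v = \<infinity> \<and>
             (\<nexists>p. admissible_walk w S (handicap G S) \<nu> \<kappa> s G p v)))))"
proof (intro exI[of _ 20] allI impI, elim conjE)
  fix G :: "('v, 'e) pre_digraph" and w S \<nu> \<kappa> s
  assume "road_network G w" "scope_mapping G S \<nu> \<kappa>" "s \<in> verts G"
  then interpret scoped_network G w S \<nu> \<kappa> s
    by (simp add: scoped_network_def scoped_network_axioms_def)
  show "sd_terminates G w S \<nu> \<kappa> (\<lambda>_. \<infinity>) s \<and>
     (\<forall>st. sd_reachable G w S \<nu> \<kappa> (\<lambda>_. \<infinity>) s st \<and> queue st = {} \<longrightarrow>
        time st \<le> 20 * (real (card (arcs G)) * real (card (levels G S))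
                       + real (card (verts G)) * log 2 (real (card (verts G)))) \<and>
        ((\<forall>e\<in>arcs G. 0 < w e) \<longrightarrow>
         (\<forall>v\<in>verts G.
            (\<exists>p. dval st v = ereal (wf_digraph.awalk_cost w p) \<and> read_off G (parc st) v p \<and>
                 optimal_admissible_walk w S (handicap G S) \<nu> \<kappa> s G p v) \<or>
            (dval st v = \<infinity> \<and>
             (\<nexists>p. admissible_walk w S (handicap G S) \<nu> \<kappa> s G p v)))))"
    using terminates time_bound final_state_correct[unfolded positive_weights_def] by blast
qed

end
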